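(* For all $c>0$ and integers $r\geq 3$ there exist $\xi=\xi(c,r)>0$, $\beta=\beta(c,r)>0$ and $n_0$ such that for every $n\geq n_0$ and every graph $G$ with $n$ vertices and $m\geq cn^2$ edges the following holds: if $k_r(G)<\xi n^r$, then there exists a partition $V(G)=V_1\cup V_2$ with $|V_1|=\lfloor n/2\rfloor$, $|V_2|=\lceil n/2\rceil$ and \[ e(V_1,V_2)>(1/2+\beta)m. \]
   Context: All graphs are finite and simple. $k_r(G)$ denotes the number of $r$-cliques of $G$. For disjoint $A,B\subset V(G)$, $e(A,B)$ is the number of edges with one endpoint in $A$ and the other in $B$. *)

theory Defs
  imports Complex_Main "HOL-Library.Ramsey"
begin

definition simple_graph :: "'a set \<Rightarrow> 'a set set \<Rightarrow> bool" where
  "simple_graph V E \<longleftrightarrow> finite V \<and> E \<subseteq> [V]\<^bsup>2\<^esup>"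

definition num_cliques :: "nat \<Rightarrow> 'a set \<Rightarrow> 'a set set \<Rightarrow> nat" where
  "num_cliques r V E = card {K \<in> [V]\<^bsup>r\<^esup>. clique K E}"

definition num_edges_between :: "'a set set \<Rightarrow> 'a set \<Rightarrow> 'a set \<Rightarrow> nat" where
  "num_edges_between E A B = card {e \<in> E. \<exists>x\<in>A. \<exists>y\<in>B. e = {x, y}}"

end

theory Submission
  imports Defs
begin

text \<open>
  If every bisection cuts at most \<open>(1/2 + \<beta>) m\<close> edges, then the adjacency form
  \<open>Q f = \<Sum> a u v f u f v\<close> is at least \<open>-\<delta> n\<^sup>2\<close> on all \<open>f : V \<rightarrow> [-1, 1]\<close> of mean zero: shifting mass
  between two vertices with fractional values is a concave perturbation of \<open>Q\<close>, so \<open>f\<close> can be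
  rounded to a \<open>\<plusminus>1\<close>-vector without increasing \<open>Q\<close>. This almost conditional positivity passes to
  every subset of \<open>V\<close>.

  Let \<open>d\<close> be the degree function and \<open>p\<close> its mean. Testing \<open>Q\<close> on the centred neighbourhood
  indicators and summing over all vertices, then testing it on \<open>d - p\<close>, bounds the number of
  ordered triangles below by \<open>p\<^sup>3 - 3 \<delta> n\<^sup>3\<close>. Hence linearly many vertices have a neighbourhood
  spanning quadratically many edges, and induction on \<open>r\<close> inside these neighbourhoods yields
  \<open>\<xi> n\<^sup>r\<close> cliques of order \<open>r\<close>.
\<close>

section \<open>Quadratic forms and almost conditional positivity\<close>

definition quad_form :: "'a set \<Rightarrow> ('a \<Rightarrow> 'a \<Rightarrow> real) \<Rightarrow> ('a \<Rightarrow> real) \<Rightarrow> real" where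
  "quad_form U a f = (\<Sum>u\<in>U. \<Sum>v\<in>U. a u v * f u * f v)"

text \<open>Conditional positive semidefiniteness with an additive error. As \<open>D\<close> does
  not scale with \<open>f\<close>, the bound \<bar>f u\<bar> \<le> 1 fixes the normalisation; a test
  function of size s has to be divided by s, which costs a factor s^2 in the error.\<close>

definition almost_cond_psd :: "'a set \<Rightarrow> ('a \<Rightarrow> 'a \<Rightarrow> real) \<Rightarrow> real \<Rightarrow> bool" where
  "almost_cond_psd U a D \<longleftrightarrow>
     (\<forall>f. (\<forall>u\<in>U. \<bar>f u\<bar> \<le> 1) \<longrightarrow> sum f U = 0 \<longrightarrow> quad_form U a f \<ge> - D)"

definition adj :: "'a set set \<Rightarrow> 'a \<Rightarrow> 'a \<Rightarrow> real" where
  "adj E u v = of_bool ({u, v} \<in> E)"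

lemma adj_commute: "adj E u v = adj E v u"
  by (simp add: adj_def insert_commute)

text \<open>Symmetry merges the two cross terms. The expansion serves twice: with \<open>g\<close>
  constant 1 it centres a test function, and with \<open>g\<close> a difference of two point
  indicators it moves mass between two vertices.\<close>

lemma quad_form_add_scaled:
  assumes sym: "\<And>u v. a u v = a v u"
  shows "quad_form U a (\<lambda>u. f u + t * g u)
     = quad_form U a f + 2 * t * (\<Sum>u\<in>U. \<Sum>v\<in>U. a u v * f u * g v) + t\<^sup>2 * quad_form U a g"
proof -
  have swap: "(\<Sum>u\<in>U. \<Sum>v\<in>U. a u v * g u * f v) = (\<Sum>u\<in>U. \<Sum>v\<in>U. a u v * f u * g v)"
    by (subst sum.swap) (simp add: sym mult.commute mult.left_commute)
  have "quad_form U a (\<lambda>u. f u + t * g u)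
      = (\<Sum>u\<in>U. \<Sum>v\<in>U. a u v * f u * f v + t * (a u v * f u * g v)
          + t * (a u v * g u * f v) + t\<^sup>2 * (a u v * g u * g v))"
    unfolding quad_form_def
    by (intro sum.cong refl) (simp add: algebra_simps power2_eq_square)
  also have "\<dots> = quad_form U a f + t * (\<Sum>u\<in>U. \<Sum>v\<in>U. a u v * f u * g v)
      + t * (\<Sum>u\<in>U. \<Sum>v\<in>U. a u v * g u * f v) + t\<^sup>2 * quad_form U a g"
    by (simp add: sum.distrib sum_distrib_left quad_form_def)
  finally show ?thesis by (simp add: swap)
qed

lemma quad_form_scale: "quad_form U a (\<lambda>u. t * f u) = t\<^sup>2 * quad_form U a f"
  by (simp add: quad_form_def sum_distrib_left power2_eq_square mult_ac)

text \<open>Extension by zero preserves the bound, the zero sum and the value of the form. The error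
  \<open>D\<close> stays the same however small \<open>W\<close> is, so later densities are all
  measured against one fixed n.\<close>

lemma almost_cond_psd_subset:
  assumes "almost_cond_psd U a D" "finite U" "W \<subseteq> U"
  shows "almost_cond_psd W a D"
  unfolding almost_cond_psd_def
proof (intro allI impI)
  fix f :: "'a \<Rightarrow> real"
  assume f: "\<forall>u\<in>W. \<bar>f u\<bar> \<le> 1" "sum f W = 0"
  define g where "g u = (if u \<in> W then f u else 0)" for u
  have gW: "(\<Sum>u\<in>U. h u * g u) = (\<Sum>u\<in>W. h u * f u)" for h
    using assms(2,3) by (intro sum.mono_neutral_cong_right) (auto simp: g_def)
  have "quad_form U a g = (\<Sum>u\<in>U. (\<Sum>v\<in>U. a u v * g v) * g u)"
    by (simp add: quad_form_def sum_distrib_left mult_ac)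
  also have "\<dots> = quad_form W a f"
    by (simp add: gW) (simp add: quad_form_def sum_distrib_left mult_ac)
  finally have "quad_form U a g = quad_form W a f" .
  moreover have "sum g U = 0" using gW[of "\<lambda>_. 1"] f by simp
  moreover have "\<forall>u\<in>U. \<bar>g u\<bar> \<le> 1" using f by (simp add: g_def)
  ultimately show "- D \<le> quad_form W a f"
    using assms(1) unfolding almost_cond_psd_def by metis
qed

section \<open>A lower bound for the number of triangles\<close>

text \<open>For a graph, \<open>quad_form U a (a v)\<close> counts ordered pairs of adjacent
  neighbours of \<open>v\<close>, so the sum counts ordered triangles, and the main term is the cube
  of the average degree. Centring every row \<open>a v\<close> costs \<open>D\<close> per vertex,
  and centring the degree function costs another \<open>2 * s * D\<close>.\<close>

lemma sum_quad_form_nbhd_ge: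
  fixes a :: "'a \<Rightarrow> 'a \<Rightarrow> real" and D :: real
  assumes fin: "finite U" and ne: "U \<noteq> {}"
    and sym: "\<And>u v. a u v = a v u"
    and a01: "\<And>u v. 0 \<le> a u v" "\<And>u v. a u v \<le> 1"
    and psd: "almost_cond_psd U a D"
  shows "(\<Sum>v\<in>U. quad_form U a (a v))
     \<ge> ((\<Sum>u\<in>U. \<Sum>v\<in>U. a u v) / card U) ^ 3 - 3 * card U * D"
proof -
  define s where "s = real (card U)"
  have s: "s > 0" using fin ne by (simp add: s_def card_gt_0_iff)
  define d where "d v = (\<Sum>u\<in>U. a v u)" for v
  define w1 where "w1 = (\<Sum>v\<in>U. d v)"
  define w2 where "w2 = (\<Sum>v\<in>U. (d v)\<^sup>2)"
  define w3 where "w3 = quad_form U a d"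
  define p where "p = w1 / s"
  have d0: "0 \<le> d v" for v by (simp add: d_def a01 sum_nonneg)
  have ds: "d v \<le> s" for v
    using sum_bounded_above[of U "a v" 1] a01 by (simp add: d_def s_def)
  have w1: "w1 = s * p" using s by (simp add: p_def)
  have "w1 \<le> s * s" unfolding w1_def using sum_bounded_above[of U d s] ds by (simp add: s_def)
  hence p: "0 \<le> p" "p \<le> s"
    using s d0 by (auto simp: p_def w1_def sum_nonneg divide_le_eq)
  have shift: "quad_form U a (\<lambda>u. f u + t * 1)
      = quad_form U a f + 2 * t * (\<Sum>u\<in>U. d u * f u) + t\<^sup>2 * w1" for f t
    unfolding quad_form_add_scaled[of a U f t "\<lambda>_. 1", OF sym]
    by (simp add: quad_form_def w1_def d_def sum_distrib_left sum_distrib_right mult_ac)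
  \<comment> \<open>The mean of \<open>a v\<close> over \<open>U\<close> is \<open>d v / s\<close>,
    so subtracting it gives an admissible test function; the claim is the expanded form of its
    inequality.\<close>
  have nbhd: "quad_form U a (a v) \<ge> 2 * d v / s * (\<Sum>u\<in>U. d u * a v u) - (d v / s)\<^sup>2 * w1 - D"
    for v
  proof -
    have "\<forall>u\<in>U. \<bar>a v u + (- d v / s) * 1\<bar> \<le> 1"
    proof
      fix u
      have "0 \<le> d v / s" "d v / s \<le> 1" using d0 ds s by auto
      with a01[of v u] show "\<bar>a v u + (- d v / s) * 1\<bar> \<le> 1" by (simp add: abs_le_iff)
    qed
    moreover have "(\<Sum>u\<in>U. a v u + (- d v / s) * 1) = 0"
      using s by (simp add: sum.distrib sum_negf sum_subtractf d_def[symmetric] s_def[symmetric])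
    ultimately have "- D \<le> quad_form U a (\<lambda>u. a v u + (- d v / s) * 1)"
      using psd unfolding almost_cond_psd_def by metis
    then show ?thesis unfolding shift by (simp add: power2_eq_square)
  qed
  have "(\<Sum>v\<in>U. quad_form U a (a v))
      \<ge> (\<Sum>v\<in>U. 2 * d v / s * (\<Sum>u\<in>U. d u * a v u) - (d v / s)\<^sup>2 * w1 - D)"
    by (intro sum_mono nbhd)
  also have "(\<Sum>v\<in>U. 2 * d v / s * (\<Sum>u\<in>U. d u * a v u) - (d v / s)\<^sup>2 * w1 - D)
      = 2 / s * w3 - w2 / s\<^sup>2 * w1 - s * D"
    by (simp add: sum_subtractf w3_def w2_def quad_form_def s_def[symmetric] sum_distrib_left
        sum_distrib_right sum_divide_distrib power_divide mult_ac)
  finally have T: "(\<Sum>v\<in>U. quad_form U a (a v)) \<ge> 2 / s * w3 - w2 / s\<^sup>2 * w1 - s * D" .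
  \<comment> \<open>The second test function is the centred degree function, divided by
    \<open>s\<close> to fit into [-1, 1]. It bounds \<open>w3\<close>, the sum of d u d v over
    adjacent pairs, from below.\<close>
  have "\<forall>u\<in>U. \<bar>(1 / s) * (d u + (- p) * 1)\<bar> \<le> 1"
  proof
    fix u
    show "\<bar>(1 / s) * (d u + (- p) * 1)\<bar> \<le> 1"
      using d0[of u] ds[of u] p s by (simp add: abs_le_iff divide_simps)
  qed
  moreover have "(\<Sum>u\<in>U. (1 / s) * (d u + (- p) * 1)) = 0"
    unfolding sum_distrib_left[symmetric]
    by (simp add: sum_subtractf w1_def[symmetric] s_def[symmetric] w1)
  ultimately have "- D \<le> quad_form U a (\<lambda>u. (1 / s) * (d u + (- p) * 1))"
    using psd unfolding almost_cond_psd_def by metis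
  also have "\<dots> = (1 / s)\<^sup>2 * (w3 + 2 * (- p) * w2 + p\<^sup>2 * w1)"
    unfolding quad_form_scale shift
    by (simp add: w3_def w2_def power2_eq_square)
  finally have "- D * s\<^sup>2 \<le> w3 - 2 * p * w2 + p\<^sup>2 * w1"
    using s by (simp add: power_divide pos_le_divide_eq)
  hence W3: "w3 \<ge> 2 * p * w2 - p ^ 3 * s - D * s\<^sup>2"
    by (simp add: w1 power2_eq_square power3_eq_cube mult_ac)
  \<comment> \<open>Nonnegativity of the degree variance. After \<open>W3\<close> is inserted below,
    \<open>w2\<close> has the positive coefficient 3p/2, so this lower bound points the right
    way.\<close>
  have "0 \<le> (\<Sum>v\<in>U. (d v - p)\<^sup>2)" by (simp add: sum_nonneg)
  also have "\<dots> = w2 - 2 * p * w1 + s * p\<^sup>2"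
    by (simp add: power2_diff sum.distrib sum_subtractf w2_def w1_def s_def sum_distrib_left
        sum_distrib_right mult_ac)
  finally have W2: "w2 \<ge> s * p\<^sup>2" by (simp add: w1 power2_eq_square mult_ac)
  have "p ^ 3 * s = p * (s * p\<^sup>2)" by (simp add: power2_eq_square power3_eq_cube)
  also have "\<dots> \<le> p * w2" using W2 p by (rule_tac mult_left_mono)
  finally have "w3 - p * w2 / 2 \<ge> p ^ 3 * s / 2 - D * s\<^sup>2" using W3 by simp
  hence "2 / s * (w3 - p * w2 / 2) \<ge> 2 / s * (p ^ 3 * s / 2 - D * s\<^sup>2)"
    using s by (intro mult_left_mono) auto
  moreover have "2 / s * (p ^ 3 * s / 2 - D * s\<^sup>2) = p ^ 3 - 2 * s * D"
    using s by (simp add: field_simps power2_eq_square)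
  moreover have "2 / s * (w3 - p * w2 / 2) = 2 / s * w3 - w2 / s\<^sup>2 * w1"
    using s by (simp add: w1 field_simps power2_eq_square)
  ultimately have "(\<Sum>v\<in>U. quad_form U a (a v)) \<ge> p ^ 3 - 3 * s * D"
    using T by simp
  then show ?thesis by (simp add: p_def w1_def d_def s_def)
qed

section \<open>Counting cliques by induction through neighbourhoods\<close>

text \<open>Adding \<open>v\<close> to a clique in its neighbourhood gives a clique with one marked
  vertex, and the pair is recovered by deleting the mark. Absence of loops keeps \<open>v\<close>
  out of its own neighbourhood, so the order really grows by one.\<close>

lemma sum_num_cliques_nbhd_le:
  assumes fin: "finite U" and irr: "\<And>u. {u} \<notin> E"
  shows "(\<Sum>v\<in>U. num_cliques r {u \<in> U. {v, u} \<in> E} E) \<le> Suc r * num_cliques (Suc r) U E"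
proof -
  define C where "C v = {K \<in> [{u \<in> U. {v, u} \<in> E}]\<^bsup>r\<^esup>. clique K E}" for v
  define C' where "C' = {K \<in> [U]\<^bsup>Suc r\<^esup>. clique K E}"
  have finC: "finite (C v)" for v
    unfolding C_def using fin by (simp add: finite_imp_finite_nsets)
  have finC': "finite C'"
    unfolding C'_def using fin by (simp add: finite_imp_finite_nsets)
  have K: "finite K \<and> card K = Suc r" if "K \<in> C'" for K
    using that by (simp add: C'_def nsets_def)
  have notin: "v \<notin> K" if "K \<in> C v" for v K
    using that irr[of v] by (auto simp: C_def nsets_def)
  have "(\<Sum>v\<in>U. num_cliques r {u \<in> U. {v, u} \<in> E} E) = card (SIGMA v:U. C v)"
    using fin finC by (simp add: card_SigmaI num_cliques_def C_def)
  also have "\<dots> \<le> card (SIGMA K:C'. K)"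
  proof (rule card_inj_on_le[where f = "\<lambda>(v, K). (insert v K, v)"])
    show "inj_on (\<lambda>(v, K). (insert v K, v)) (SIGMA v:U. C v)"
    proof (rule inj_onI, clarsimp)
      fix v K L assume "K \<in> C v" "L \<in> C v" "insert v K = insert v L"
      then show "K = L" using insert_ident[of v K L] notin by blast
    qed
    show "(\<lambda>(v, K). (insert v K, v)) ` (SIGMA v:U. C v) \<subseteq> (SIGMA K:C'. K)"
    proof clarsimp
      fix v K assume v: "v \<in> U" "K \<in> C v"
      have "clique (insert v K) E"
        using v(2) unfolding clique_def C_def nsets_def by (auto simp: insert_commute)
      then show "insert v K \<in> C'"
        using v notin[OF v(2)] by (auto simp: C_def C'_def nsets_def)
    qed
    show "finite (SIGMA K:C'. K)" using finC' K by (intro finite_SigmaI) auto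
  qed
  also have "\<dots> = Suc r * card C'"
    using finC' K by (simp add: card_SigmaI)
  finally show ?thesis by (simp add: num_cliques_def C'_def)
qed

text \<open>The scale \<open>n\<close> is kept apart from \<open>card U\<close> so that the
  induction can pass to neighbourhoods without renormalising density, error or clique count. The
  triangle bound yields linearly many vertices whose neighbourhoods are dense enough for the
  induction hypothesis.\<close>

lemma num_cliques_ge_of_almost_cond_psd:
  assumes "c > 0"
  shows "\<exists>\<xi>>0. \<exists>\<delta>>0. \<forall>n>0. \<forall>(U :: 'a set) E. finite U \<longrightarrow> card U \<le> n \<longrightarrow> (\<forall>u. {u} \<notin> E) \<longrightarrow>
      almost_cond_psd U (adj E) (\<delta> * real n ^ 2) \<longrightarrow>
      (\<Sum>u\<in>U. \<Sum>v\<in>U. adj E u v) \<ge> c * real n ^ 2 \<longrightarrow>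
      real (num_cliques r U E) \<ge> \<xi> * real n ^ r"
  using assms
proof (induction r arbitrary: c)
  case 0
  have "num_cliques 0 U E = 1" for U :: "'a set" and E
  proof -
    have "{K \<in> [U]\<^bsup>0\<^esup>. clique K E} = {{}}" by (auto simp: nsets_def clique_def)
    then show ?thesis by (simp add: num_cliques_def)
  qed
  then show ?case by (intro exI[of _ 1] conjI) simp_all
next
  case (Suc r)
  \<comment> \<open>The triangle bound gives c^3 n^3, of which the error takes at most half by the
    choice of \<open>\<eta>\<close> below, leaving 2 q n^3. Vertices under the threshold q n^2 use
    up at most q n^3 of this.\<close>
  define q where "q = c ^ 3 / 4"
  have q: "q > 0" using Suc.prems by (simp add: q_def)
  obtain \<xi> \<delta> where pos: "\<xi> > 0" "\<delta> > 0" and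
    IH: "\<forall>n>0. \<forall>(U :: 'a set) E. finite U \<longrightarrow> card U \<le> n \<longrightarrow> (\<forall>u. {u} \<notin> E) \<longrightarrow>
      almost_cond_psd U (adj E) (\<delta> * real n ^ 2) \<longrightarrow>
      (\<Sum>u\<in>U. \<Sum>v\<in>U. adj E u v) \<ge> q * real n ^ 2 \<longrightarrow>
      real (num_cliques r U E) \<ge> \<xi> * real n ^ r"
    using Suc.IH[OF q] by (elim exE conjE)
  define \<eta> where "\<eta> = min \<delta> (c ^ 3 / 6)"
  have \<eta>: "\<eta> > 0" "\<eta> \<le> \<delta>" "\<eta> \<le> c ^ 3 / 6" using pos Suc.prems by (auto simp: \<eta>_def)
  \<comment> \<open>At least q n vertices contribute \<xi> n^r cliques each, and every larger clique
    is counted at most r + 1 times.\<close>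
  define \<zeta> where "\<zeta> = q * \<xi> / Suc r"
  have \<zeta>: "\<zeta> > 0" using q pos by (simp add: \<zeta>_def)
  have step: "real (num_cliques (Suc r) U E) \<ge> \<zeta> * real n ^ Suc r"
    if n: "n > 0" and fin: "finite U" and cU: "card U \<le> n" and irr: "\<forall>u. {u} \<notin> E"
      and psd: "almost_cond_psd U (adj E) (\<eta> * real n ^ 2)"
      and dense: "(\<Sum>u\<in>U. \<Sum>v\<in>U. adj E u v) \<ge> c * real n ^ 2" for n and U :: "'a set" and E
  proof -
    define a where "a = adj E"
    define N where "N v = {u \<in> U. {v, u} \<in> E}" for v
    define Q where "Q v = quad_form U a (a v)" for v
    define G where "G = {v \<in> U. Q v \<ge> q * real n ^ 2}"
    have a01: "0 \<le> a u v" "a u v \<le> 1" for u v by (auto simp: a_def adj_def)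
    have "c * real n ^ 2 > 0" using n Suc.prems by simp
    hence ne: "U \<noteq> {}" using dense by auto
    hence s: "real (card U) > 0" using fin by (simp add: card_gt_0_iff)
    have QN: "Q v = (\<Sum>u\<in>N v. \<Sum>w\<in>N v. a u w)" for v
    proof -
      have restr: "(\<Sum>u\<in>U. h u * a v u) = (\<Sum>u\<in>N v. h u)" for h
        using fin by (intro sum.mono_neutral_cong_right) (auto simp: N_def a_def adj_def)
      have "Q v = (\<Sum>u\<in>U. (\<Sum>w\<in>U. a u w * a v w) * a v u)"
        by (simp add: Q_def quad_form_def sum_distrib_left mult_ac)
      then show ?thesis by (simp add: restr)
    qed
    have Qle: "Q v \<le> real n ^ 2" for v
    proof -
      have cN: "real (card (N v)) \<le> real n"
        using card_mono[OF fin, of "N v"] cU by (auto simp: N_def)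
      have "Q v \<le> (\<Sum>u\<in>N v. \<Sum>w\<in>N v. 1)"
        unfolding QN by (intro sum_mono a01)
      also have "\<dots> = real (card (N v)) * real (card (N v))" by simp
      also have "\<dots> \<le> real n * real n" by (intro mult_mono cN) auto
      finally show ?thesis by (simp add: power2_eq_square)
    qed
    \<comment> \<open>Since \<open>card U \<le> n\<close>, the average degree inside
      \<open>U\<close> is at least c n even when \<open>U\<close> is much smaller than n.\<close>
    have "c * real n * real (card U) \<le> c * real n * real n"
      using cU Suc.prems by (intro mult_left_mono) auto
    also have "\<dots> \<le> (\<Sum>u\<in>U. \<Sum>v\<in>U. a u v)"
      using dense by (simp add: a_def power2_eq_square mult_ac)
    finally have "c * real n \<le> (\<Sum>u\<in>U. \<Sum>v\<in>U. a u v) / card U"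
      using s by (simp add: pos_le_divide_eq)
    hence avg: "(c * real n) ^ 3 \<le> ((\<Sum>u\<in>U. \<Sum>v\<in>U. a u v) / card U) ^ 3"
      using Suc.prems by (intro power_mono) auto
    have "real (card U) * (\<eta> * real n ^ 2) \<le> real n * (c ^ 3 / 6 * real n ^ 2)"
      using cU \<eta> Suc.prems by (intro mult_mono) auto
    hence "3 * real (card U) * (\<eta> * real n ^ 2) \<le> 2 * q * real n ^ 3"
      by (simp add: q_def power2_eq_square power3_eq_cube mult_ac)
    moreover have "(c * real n) ^ 3 = 4 * q * real n ^ 3"
      by (simp add: q_def power_mult_distrib)
    moreover have "((\<Sum>u\<in>U. \<Sum>v\<in>U. a u v) / card U) ^ 3 - 3 * card U * (\<eta> * real n ^ 2) \<le> sum Q U"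
      unfolding Q_def using fin ne a01 psd
      by (intro sum_quad_form_nbhd_ge) (auto simp: a_def adj_commute)
    ultimately have low: "2 * q * real n ^ 3 \<le> sum Q U"
      using avg by linarith
    \<comment> \<open>Cap \<open>Q\<close> by n^2 on \<open>G\<close> and by q n^2 elsewhere;
      comparison with \<open>low\<close> forces \<open>G\<close> to have at least q n
      vertices.\<close>
    have "sum Q U \<le> (\<Sum>v\<in>U. (if v \<in> G then real n ^ 2 else 0) + q * real n ^ 2)"
    proof (rule sum_mono)
      fix v assume "v \<in> U"
      then show "Q v \<le> (if v \<in> G then real n ^ 2 else 0) + q * real n ^ 2"
        using Qle[of v] q by (auto simp: G_def intro: add_increasing2)
    qed
    also have "\<dots> = real (card G) * real n ^ 2 + card U * (q * real n ^ 2)"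
    proof -
      have "G \<subseteq> U" by (auto simp: G_def)
      then show ?thesis
        using fin by (simp add: sum.distrib sum.If_cases Int_absorb1)
    qed
    also have "card U * (q * real n ^ 2) \<le> n * (q * real n ^ 2)"
      using cU q by (intro mult_right_mono) auto
    finally have "q * real n * real n ^ 2 \<le> real (card G) * real n ^ 2"
      using low by (simp add: power2_eq_square power3_eq_cube mult_ac)
    hence G: "q * real n \<le> real (card G)"
      using n by (simp add: mult_le_cancel_right)
    have cl: "real (num_cliques r (N v) E) \<ge> \<xi> * real n ^ r" if "v \<in> G" for v
    proof (rule IH[rule_format, OF n _ _ irr[rule_format]])
      show "finite (N v)" using fin by (simp add: N_def)
      show "card (N v) \<le> n"
        using card_mono[OF fin, of "N v"] cU by (auto simp: N_def)
      have "almost_cond_psd (N v) (adj E) (\<eta> * real n ^ 2)"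
        by (rule almost_cond_psd_subset[OF psd fin]) (auto simp: N_def)
      moreover have "\<eta> * real n ^ 2 \<le> \<delta> * real n ^ 2"
        using \<eta> by (intro mult_right_mono) auto
      ultimately show "almost_cond_psd (N v) (adj E) (\<delta> * real n ^ 2)"
        unfolding almost_cond_psd_def by force
      show "q * real n ^ 2 \<le> (\<Sum>u\<in>N v. \<Sum>w\<in>N v. adj E u w)"
        using that QN[of v] by (simp add: G_def a_def)
    qed
    have "q * real n * (\<xi> * real n ^ r) \<le> real (card G) * (\<xi> * real n ^ r)"
      using G pos by (intro mult_right_mono) auto
    also have "\<dots> \<le> (\<Sum>v\<in>G. real (num_cliques r (N v) E))"
      using sum_mono[of G "\<lambda>_. \<xi> * real n ^ r"] cl by simp
    also have "\<dots> \<le> (\<Sum>v\<in>U. real (num_cliques r (N v) E))"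
      using fin by (intro sum_mono2) (auto simp: G_def)
    also have "\<dots> \<le> real (Suc r * num_cliques (Suc r) U E)"
      using sum_num_cliques_nbhd_le[OF fin, of E r] irr
      unfolding N_def of_nat_sum[symmetric] of_nat_le_iff by blast
    finally have "q * real n * (\<xi> * real n ^ r) \<le> real (num_cliques (Suc r) U E) * real (Suc r)"
      by (simp only: of_nat_mult mult.commute)
    then show ?thesis
      by (simp add: \<zeta>_def pos_divide_le_eq mult_ac del: of_nat_Suc)
  qed
  show ?case
    by (intro exI[of _ \<zeta>] exI[of _ \<eta>] conjI allI impI; (rule \<zeta> \<eta>(1) | rule step; assumption))
qed

section \<open>Rounding test functions to signs\<close>

text \<open>Induction on the number of fractional vertices: as long as two remain, mass moves
  between them, which keeps the sum, until one reaches 1 or -1. A single leftover cannot be removed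
  this way, whence the bound 1.\<close>

lemma quad_form_round:
  fixes f :: "'a \<Rightarrow> real"
  assumes fin: "finite U"
    and sym: "\<And>u v. a u v = a v u"
    and irr: "\<And>u. a u u = 0"
    and nonneg: "\<And>u v. 0 \<le> a u v"
    and "\<And>u. u \<in> U \<Longrightarrow> \<bar>f u\<bar> \<le> 1"
  shows "\<exists>g. (\<forall>u\<in>U. \<bar>g u\<bar> \<le> 1) \<and> sum g U = sum f U \<and> quad_form U a g \<le> quad_form U a f \<and>
     card {u \<in> U. \<bar>g u\<bar> \<noteq> 1} \<le> 1"
  using assms(5)
proof (induction "card {u \<in> U. \<bar>f u\<bar> \<noteq> 1}" arbitrary: f rule: less_induct)
  case less
  let ?F = "\<lambda>f. {u \<in> U. \<bar>f u\<bar> \<noteq> (1::real)}"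
  show ?case
  proof (cases "card (?F f) \<le> 1")
    case True
    with less.prems show ?thesis by blast
  next
    case False
    then obtain x y where xy: "x \<in> ?F f" "y \<in> ?F f" "x \<noteq> y"
      using fin card_le_Suc0_iff_eq[of "?F f"] by auto
    have lt: "\<bar>f x\<bar> < 1" "\<bar>f y\<bar> < 1"
      using xy less.prems by (auto simp: less_le)
    define e :: "'a \<Rightarrow> real" where "e u = of_bool (u = x) - of_bool (u = y)" for u
    define B where "B = (\<Sum>u\<in>U. \<Sum>v\<in>U. a u v * f u * e v)"
    \<comment> \<open>The sign of \<open>t\<close> makes the linear term \<open>2 * t * B\<close>
      nonpositive; its size is the largest that keeps both values in [-1, 1], so one of them hits
      the boundary.\<close>
    define t where "t = (if B \<le> 0 then min (1 - f x) (1 + f y) else - min (1 + f x) (1 - f y))"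
    define h where "h u = f u + t * e u" for u
    have ex: "e x = 1" "e y = -1" "\<And>u. u \<noteq> x \<Longrightarrow> u \<noteq> y \<Longrightarrow> e u = 0"
      using xy by (auto simp: e_def)
    have sum_e: "(\<Sum>u\<in>U. k u * e u) = k x - k y" for k
    proof -
      have "k u * e u = (if u = x then k u else 0) - (if u = y then k u else 0)" for u
        by (simp add: e_def)
      then show ?thesis using fin xy by (simp add: sum_subtractf)
    qed
    \<comment> \<open>\<open>Q\<close> is concave along \<open>e\<close>, so one of the two extreme admissible shifts does not increase it.\<close>
    have "quad_form U a e = (\<Sum>u\<in>U. (\<Sum>v\<in>U. a u v * e v) * e u)"
      by (simp add: quad_form_def sum_distrib_left mult_ac)
    also have "\<dots> = - 2 * a x y" by (simp add: sum_e irr sym[of y x])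
    finally have "t\<^sup>2 * quad_form U a e \<le> 0"
      using nonneg by (simp add: mult_nonneg_nonpos)
    moreover have "t * B \<le> 0"
    proof (cases "B \<le> 0")
      case True
      then have "t \<ge> 0" using lt by (simp add: t_def abs_less_iff)
      with True show ?thesis by (simp add: mult_nonneg_nonpos)
    next
      case False
      then have "t \<le> 0" using lt by (simp add: t_def abs_less_iff)
      with False show ?thesis by (simp add: mult_nonpos_nonneg)
    qed
    ultimately have Qh: "quad_form U a h \<le> quad_form U a f"
      using quad_form_add_scaled[of a U f t e, OF sym] by (simp add: h_def[abs_def] B_def)
    have hx: "\<bar>h x\<bar> \<le> 1" "\<bar>h y\<bar> \<le> 1" "\<bar>h x\<bar> = 1 \<or> \<bar>h y\<bar> = 1"
      using lt by (auto simp: h_def ex t_def min_def abs_le_iff abs_less_iff)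
    have heq: "h u = f u" if "u \<noteq> x" "u \<noteq> y" for u
      using that by (simp add: h_def ex)
    have h1: "\<bar>h u\<bar> \<le> 1" if "u \<in> U" for u
      using hx heq less.prems[OF that] by metis
    have "?F h \<subset> ?F f"
    proof
      show "?F h \<subseteq> ?F f" using xy heq by force
      show "?F h \<noteq> ?F f" using hx(3) xy by blast
    qed
    hence "card (?F h) < card (?F f)"
      using fin by (intro psubset_card_mono) auto
    from less.hyps[OF this h1] obtain g where
      g: "\<forall>u\<in>U. \<bar>g u\<bar> \<le> 1" "sum g U = sum h U" "quad_form U a g \<le> quad_form U a h"
        "card (?F g) \<le> 1"
      by blast
    have "sum h U = sum f U"
      using sum_e[of "\<lambda>_. t"] by (simp add: h_def sum.distrib)
    with g Qh show ?thesis by (intro exI[of _ g]) simp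
  qed
qed

section \<open>From cuts to the adjacency form\<close>

lemma sum_adj_eq:
  assumes "simple_graph V E"
  shows "(\<Sum>u\<in>V. \<Sum>v\<in>V. adj E u v) = 2 * real (card E)"
proof -
  have fin: "finite V" and E: "E \<subseteq> [V]\<^bsup>2\<^esup>"
    using assms by (auto simp: simple_graph_def)
  have finE: "finite E" using E fin by (meson finite_imp_finite_nsets finite_subset)
  have two: "(\<Sum>u\<in>V. \<Sum>v\<in>V. of_bool ({u, v} = e)) = (2::real)" if "e \<in> E" for e
  proof -
    obtain x y where e: "e = {x, y}" "x \<noteq> y" "x \<in> V" "y \<in> V"
      using \<open>e \<in> E\<close> E by (auto simp: nsets_def card_2_iff)
    have "of_bool ({u, v} = e) = of_bool (u = x) * of_bool (v = y)
        + of_bool (u = y) * (of_bool (v = x) :: real)" for u v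
      using e by (auto simp: doubleton_eq_iff)
    moreover have "(\<Sum>v\<in>V. of_bool (v = x)) = (1::real)" "(\<Sum>v\<in>V. of_bool (v = y)) = (1::real)"
      using e fin by (simp_all add: of_bool_def)
    ultimately show ?thesis
      by (simp add: sum.distrib sum_distrib_left[symmetric])
  qed
  have "adj E u v = (\<Sum>e\<in>E. of_bool ({u, v} = e))" for u v
    using finE by (simp add: adj_def of_bool_def)
  hence "(\<Sum>u\<in>V. \<Sum>v\<in>V. adj E u v) = (\<Sum>u\<in>V. \<Sum>e\<in>E. \<Sum>v\<in>V. of_bool ({u, v} = e))"
    by (simp only:) (subst (2) sum.swap, rule refl)
  also have "\<dots> = (\<Sum>e\<in>E. \<Sum>u\<in>V. \<Sum>v\<in>V. of_bool ({u, v} = e))"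
    by (rule sum.swap)
  also have "\<dots> = 2 * real (card E)" using two by simp
  finally show ?thesis .
qed

text \<open>Disjointness lets the ordered pair be read off from the edge, so distinct pairs give
  distinct crossing edges.\<close>

lemma sum_adj_le_num_edges_between:
  assumes "finite E" "A \<inter> B = {}" "finite A" "finite B"
  shows "(\<Sum>u\<in>A. \<Sum>v\<in>B. adj E u v) \<le> real (num_edges_between E A B)"
proof -
  define P where "P = {(u, v). u \<in> A \<and> v \<in> B \<and> {u, v} \<in> E}"
  have "P \<subseteq> A \<times> B" by (auto simp: P_def)
  have "(\<Sum>u\<in>A. \<Sum>v\<in>B. adj E u v) = (\<Sum>p\<in>A \<times> B. of_bool (p \<in> P))"
    unfolding sum.cartesian_product by (intro sum.cong) (auto simp: P_def adj_def)
  also have "\<dots> = real (card P)"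
    using assms \<open>P \<subseteq> A \<times> B\<close> by (simp add: of_bool_def sum.If_cases Int_absorb1)
  also have "card P \<le> card {e \<in> E. \<exists>x\<in>A. \<exists>y\<in>B. e = {x, y}}"
  proof (rule card_inj_on_le[where f = "\<lambda>(u, v). {u, v}"])
    show "inj_on (\<lambda>(u, v). {u, v}) P"
      using assms(2) by (auto simp: inj_on_def P_def doubleton_eq_iff)
  qed (use assms(1) in \<open>auto simp: P_def\<close>)
  finally show ?thesis by (simp add: num_edges_between_def)
qed

text \<open>A sign vector with cut X has form value 2m - 4X, which the hypothesis bounds below by
  \<open>-4 * \<beta> * m\<close> for a bisection. Rounding reduces any test function to such a
  vector, except for one possible leftover vertex, which accounts for the term
  \<open>2 * card V\<close>.\<close>

lemma almost_cond_psd_of_bisections: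
  fixes \<beta> :: real
  assumes G: "simple_graph V E"
    and bis: "\<And>V1 V2. \<lbrakk>V1 \<union> V2 = V; V1 \<inter> V2 = {}; card V1 = card V div 2\<rbrakk> \<Longrightarrow>
      real (num_edges_between E V1 V2) \<le> (1/2 + \<beta>) * real (card E)"
  shows "almost_cond_psd V (adj E) (4 * \<beta> * real (card E) + 2 * real (card V))"
  unfolding almost_cond_psd_def
proof (intro allI impI)
  fix f :: "'a \<Rightarrow> real"
  assume f: "\<forall>u\<in>V. \<bar>f u\<bar> \<le> 1" "sum f V = 0"
  define a where "a = adj E"
  have fin: "finite V" and E: "E \<subseteq> [V]\<^bsup>2\<^esup>"
    using G by (auto simp: simple_graph_def)
  have finE: "finite E" using E fin by (meson finite_imp_finite_nsets finite_subset)
  have a01: "0 \<le> a u v" "a u v \<le> 1" and sym: "a u v = a v u" for u v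
    by (auto simp: a_def adj_def insert_commute)
  have irr: "a u u = 0" for u using E by (auto simp: a_def adj_def nsets_def)
  obtain g where g: "\<forall>u\<in>V. \<bar>g u\<bar> \<le> 1" "sum g V = 0"
      "quad_form V a g \<le> quad_form V a f" "card {u \<in> V. \<bar>g u\<bar> \<noteq> 1} \<le> 1"
    using quad_form_round[of V a f, OF fin sym irr a01(1)] f by auto
  define P where "P = {u \<in> V. g u = 1}"
  define M where "M = {u \<in> V. g u = - 1}"
  define F where "F = {u \<in> V. \<bar>g u\<bar> \<noteq> 1}"
  have VU: "V = P \<union> M \<union> F" by (auto simp: P_def M_def F_def abs_if)
  have disj: "P \<inter> M = {}" "(P \<union> M) \<inter> F = {}" by (auto simp: P_def M_def F_def)
  have fins: "finite P" "finite M" "finite F" using fin by (auto simp: P_def M_def F_def)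
  have cV: "card V = card P + card M + card F"
    unfolding VU using disj fins by (simp add: card_Un_disjoint)
  have "sum g V = sum g P + sum g M + sum g F"
    unfolding VU using disj fins by (simp add: sum.union_disjoint)
  moreover have "sum g P = card P" "sum g M = - real (card M)"
    by (simp_all add: P_def M_def)
  ultimately have balance: "real (card P) - real (card M) + sum g F = 0"
    using g by simp
  \<comment> \<open>By the zero sum, the leftover value is an integer of absolute value below 1,
    hence 0. So \<open>P\<close> and \<open>M\<close> have equal size and a leftover occurs only for
    odd \<open>card V\<close>.\<close>
  have gF: "sum g F = 0 \<and> (\<forall>u\<in>F. g u = 0)"
  proof (cases "F = {}")
    case False
    then obtain x where x: "F = {x}"
      using g(4) fins unfolding F_def[symmetric]
      by (metis One_nat_def card_1_singletonE card_0_eq le_Suc_eq le_zero_eq)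
    have "g x = real_of_int (int (card M) - int (card P))"
      using balance x by simp
    moreover have "\<bar>g x\<bar> < 1" using x g(1) by (auto simp: F_def less_le)
    ultimately have "g x = 0" by (metis of_int_0 of_int_1 of_int_abs of_int_less_iff zabs_less_one_iff)
    then show ?thesis using x by simp
  qed simp
  hence "card P = card M" using balance by simp
  hence half: "card P = card V div 2"
    using cV g(4) unfolding F_def[symmetric] by linarith
  \<comment> \<open>The leftover vertex joins the negative side, so \<open>P\<close> is the smaller
    half; \<open>e\<close> is the resulting correction, supported on at most one vertex.\<close>
  define h where "h u = (if u \<in> P then 1 else - 1 :: real)" for u
  define e where "e u = (if u \<in> F then - 1 else 0 :: real)" for u
  have hg: "h u = g u + 1 * e u" if "u \<in> V" for u
    using that gF by (auto simp: h_def e_def P_def F_def abs_if split: if_splits)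
  have Qcong: "quad_form V a h = quad_form V a (\<lambda>u. g u + 1 * e u)"
    unfolding quad_form_def using hg by (intro sum.cong refl) simp
  have sum_e: "(\<Sum>u\<in>V. k u * e u) = - (\<Sum>u\<in>F. k u)" for k
  proof -
    have "(\<Sum>u\<in>V. k u * e u) = (\<Sum>u\<in>F. - k u)"
      using fin by (intro sum.mono_neutral_cong_right) (auto simp: e_def F_def)
    then show ?thesis by (simp add: sum_negf)
  qed
  have "quad_form V a e = (\<Sum>u\<in>V. (\<Sum>v\<in>V. a u v * e v) * e u)"
    by (simp add: quad_form_def sum_distrib_left mult_ac)
  also have "\<dots> = (\<Sum>u\<in>F. \<Sum>v\<in>F. a u v)" by (simp add: sum_e sum_negf)
  also have "\<dots> = 0"
    using g(4) fins(3) irr unfolding F_def[symmetric]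
    by (intro sum.neutral ballI) (metis One_nat_def card_le_Suc0_iff_eq)
  finally have Qe: "quad_form V a e = 0" .
  have cross: "(\<Sum>u\<in>V. \<Sum>v\<in>V. a u v * g u * e v) \<le> real (card V)"
  proof -
    have "(\<Sum>v\<in>V. a u v * g u * e v) \<le> 1" if u: "u \<in> V" for u
    proof -
      have b: "- (a u v * g u) \<le> 1" for v
      proof -
        have "\<bar>a u v * g u\<bar> \<le> 1 * 1"
          unfolding abs_mult using a01[of u v] g(1) u by (intro mult_mono) auto
        then show ?thesis by linarith
      qed
      have "(\<Sum>v\<in>V. a u v * g u * e v) = (\<Sum>v\<in>F. - (a u v * g u))"
        by (simp add: sum_e sum_negf)
      also have "\<dots> \<le> real (card F) * 1" using b by (intro sum_bounded_above)
      also have "\<dots> \<le> 1" using g(4) by (simp add: F_def)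
      finally show ?thesis .
    qed
    from sum_bounded_above[of V, OF this] show ?thesis by simp
  qed
  have up: "quad_form V a h \<le> quad_form V a g + 2 * real (card V)"
    using quad_form_add_scaled[of a V g 1 e, OF sym] Qe cross Qcong by simp
  have PV: "P \<union> (V - P) = V" "P \<inter> (V - P) = {}" by (auto simp: P_def)
  define X where "X = (\<Sum>u\<in>P. \<Sum>v\<in>V - P. a u v)"
  have X: "X \<le> (1/2 + \<beta>) * real (card E)"
    using sum_adj_le_num_edges_between[OF finE PV(2)] fin fins(1) bis[OF PV half]
    by (simp add: X_def a_def)
  have split: "(\<Sum>u\<in>V. k u) = (\<Sum>u\<in>P. k u) + (\<Sum>u\<in>V - P. k u)" for k :: "'a \<Rightarrow> real"
    using fin by (subst add.commute, intro sum.subset_diff) (auto simp: P_def)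
  have hP: "(\<Sum>u\<in>P. k u * h u) = (\<Sum>u\<in>P. k u)" "(\<Sum>u\<in>V - P. k u * h u) = - (\<Sum>u\<in>V - P. k u)" for k
    by (simp_all add: h_def sum_negf)
  have "quad_form V a h = (\<Sum>u\<in>V. (\<Sum>v\<in>V. a u v * h v) * h u)"
    by (simp add: quad_form_def sum_distrib_left mult_ac)
  also have "\<dots> = (\<Sum>u\<in>V. \<Sum>v\<in>V. a u v) - 2 * X - 2 * (\<Sum>u\<in>V - P. \<Sum>v\<in>P. a u v)"
    by (simp add: split hP sum.distrib sum_subtractf X_def)
  also have "(\<Sum>u\<in>V - P. \<Sum>v\<in>P. a u v) = X"
    unfolding X_def by (subst sum.swap) (simp add: sym)
  finally have "quad_form V a h = 2 * real (card E) - 4 * X"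
    using sum_adj_eq[OF G] by (simp add: a_def)
  with up g(3) X show "- (4 * \<beta> * real (card E) + 2 * real (card V)) \<le> quad_form V (adj E) f"
    by (simp add: a_def algebra_simps)
qed

section \<open>Choice of constants and the contrapositive\<close>

theorem theorem4:
  fixes c :: real and r :: nat
  assumes "c > 0" and "r \<ge> 3"
  shows "\<exists>\<xi>::real. \<exists>\<beta>::real. \<exists>n0::nat. \<xi> > 0 \<and> \<beta> > 0 \<and>
    (\<forall>n\<ge>n0. \<forall>(V :: 'a set) E m.
       simple_graph V E \<longrightarrow> card V = n \<longrightarrow> card E = m \<longrightarrow> real m \<ge> c * real n ^ 2 \<longrightarrow>
       real (num_cliques r V E) < \<xi> * real n ^ r \<longrightarrow>
       (\<exists>V1 V2. V1 \<union> V2 = V \<and> V1 \<inter> V2 = {} \<and>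
          int (card V1) = \<lfloor>real n / 2\<rfloor> \<and> int (card V2) = \<lceil>real n / 2\<rceil> \<and>
          real (num_edges_between E V1 V2) > (1/2 + \<beta>) * real m))"
proof -
  \<comment> \<open>The density is \<open>2 * c\<close> because the double sum of \<open>adj\<close>
    counts each edge twice.\<close>
  obtain \<xi> \<delta> where pos: "\<xi> > 0" "\<delta> > 0" and
    cl: "\<And>n (U :: 'a set) E. \<lbrakk>n > 0; finite U; card U \<le> n; \<forall>u. {u} \<notin> E;
      almost_cond_psd U (adj E) (\<delta> * real n ^ 2);
      (\<Sum>u\<in>U. \<Sum>v\<in>U. adj E u v) \<ge> 2 * c * real n ^ 2\<rbrakk> \<Longrightarrow>
      real (num_cliques r U E) \<ge> \<xi> * real n ^ r"
    using num_cliques_ge_of_almost_cond_psd[of "2 * c" r, where ?'a = 'a] assms(1)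
    by (metis zero_less_mult_iff zero_less_numeral)
  \<comment> \<open>The error \<open>\<delta> * n^2\<close> is split evenly: as 2m \<le> n^2, this
    \<open>\<beta>\<close> keeps \<open>4 * \<beta> * m\<close> within one half, and n \<ge>
    4/\<delta> keeps 2n within the other.\<close>
  define \<beta> where "\<beta> = \<delta> / 4"
  define n0 where "n0 = Suc (nat \<lceil>4 / \<delta>\<rceil>)"
  have main: "\<exists>V1 V2. V1 \<union> V2 = V \<and> V1 \<inter> V2 = {} \<and>
          int (card V1) = \<lfloor>real n / 2\<rfloor> \<and> int (card V2) = \<lceil>real n / 2\<rceil> \<and>
          real (num_edges_between E V1 V2) > (1/2 + \<beta>) * real m"
    if n: "n \<ge> n0" and G: "simple_graph V E" and cV: "card V = n" and m: "card E = m"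
      and dense: "real m \<ge> c * real n ^ 2"
      and few: "real (num_cliques r V E) < \<xi> * real n ^ r" for n m and V :: "'a set" and E
  proof (rule ccontr)
    assume no: "\<not> ?thesis"
    have fin: "finite V" and E: "E \<subseteq> [V]\<^bsup>2\<^esup>"
      using G by (auto simp: simple_graph_def)
    have "real (num_edges_between E V1 V2) \<le> (1/2 + \<beta>) * real (card E)"
      if V12: "V1 \<union> V2 = V" "V1 \<inter> V2 = {}" "card V1 = card V div 2" for V1 V2
    proof -
      have "finite V1" "finite V2" using V12 fin by auto
      hence "card V = card V1 + card V2" using V12 by (metis card_Un_disjoint)
      hence c2: "card V2 = n - n div 2" using V12 cV by simp
      have "int (card V1) = \<lfloor>real n / 2\<rfloor>"
        using V12(3) cV floor_divide_of_nat_eq[of n 2, where ?'a = real] by simp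
      moreover have "int (card V2) = \<lceil>real n / 2\<rceil>"
        unfolding c2 by (rule ceiling_unique[symmetric]; cases "even n"; auto elim!: evenE oddE)
      ultimately show ?thesis using no V12(1,2) m not_le by blast
    qed
    from almost_cond_psd_of_bisections[OF G this]
    have psd: "almost_cond_psd V (adj E) (4 * \<beta> * real m + 2 * real n)"
      by (simp add: cV m)
    have sumE: "(\<Sum>u\<in>V. \<Sum>v\<in>V. adj E u v) = 2 * real m"
      using sum_adj_eq[OF G] m by simp
    have "(\<Sum>u\<in>V. \<Sum>v\<in>V. adj E u v) \<le> (\<Sum>u\<in>V. \<Sum>v\<in>V. 1)"
      by (intro sum_mono) (simp add: adj_def)
    hence "2 * real m \<le> real n ^ 2" using sumE cV by (simp add: power2_eq_square)
    hence "4 * \<beta> * real m \<le> \<delta> / 2 * real n ^ 2"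
      using pos by (simp add: \<beta>_def)
    moreover have "4 / \<delta> \<le> real n" using n unfolding n0_def by linarith
    hence "4 * real n \<le> \<delta> * real n * real n"
      using pos by (intro mult_right_mono) (simp_all add: field_simps)
    ultimately have "4 * \<beta> * real m + 2 * real n \<le> \<delta> * real n ^ 2"
      by (simp add: power2_eq_square)
    with psd have "almost_cond_psd V (adj E) (\<delta> * real n ^ 2)"
      unfolding almost_cond_psd_def by force
    moreover have "\<forall>u. {u} \<notin> E" using E by (auto simp: nsets_def)
    moreover have "n > 0" using n by (simp add: n0_def)
    ultimately have "real (num_cliques r V E) \<ge> \<xi> * real n ^ r"
      using cl[of n V E] fin cV dense sumE by simp
    with few show False by simp
  qed
  show ?thesis
    by (rule exI[of _ \<xi>], rule exI[of _ \<beta>], rule exI[of _ n0])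
      (use main pos in \<open>auto simp: \<beta>_def\<close>)
qed

end
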